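(* Let $\mathcal{V}$ be a separable Hilbert space over $\mathbb{K}=\mathbb{R}$ or $\mathbb{C}$, let $a:\mathcal{V}\times\mathcal{V}\to\mathbb{K}$ be a sesquilinear form with $|a(u,v)|\le M\|u\|_{\mathcal{V}}\|v\|_{\mathcal{V}}$ for all $u,v\in\mathcal{V}$, where $M>0$, and let $(\mathcal{V}_n)_{n\in\mathbb{N}^*}$ be an approximating sequence of $\mathcal{V}$. Assume that $\beta>0$ is such that for all $n\in\mathbb{N}^*$, $$\sup_{v\in\mathcal{V}_n,\|v\|_{\mathcal{V}}=1}|a(u,v)|\ge\beta\|u\|_{\mathcal{V}}\quad\text{for all }u\in\mathcal{V}_n.$$ Let $\mathcal{H}$ be a Hilbert space such that $\mathcal{V}\hookrightarrow\mathcal{H}$ continuously with dense range, and let $\mathcal{X}$ be a Banach space with $\mathcal{X}\hookrightarrow\mathcal{V}'$ continuously. Let $L\in\mathcal{X}$, let $u\in\mathcal{V}$ be the solution of $a(u,v)=\langle L,v\rangle$ for all $v\in\mathcal{V}$, and for $n\in\mathbb{N}^*$ let $u_n\in\mathcal{V}_n$ be the solution of $a(u_n,\chi)=\langle L,\chi\rangle$ for all $\chi\in\mathcal{V}_n$. Then $$\|u-u_n\|_{\mathcal{H}}\le\frac{M^2}{\beta}\,\gamma_n(\mathcal{X})\,\gamma_n^*(\mathcal{H})\,\|L\|_{\mathcal{X}}\quad\text{for all }n\in\mathbb{N}^*.$$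
   Context: $\mathbb{N}^*=\{1,2,\dots\}$. A sesquilinear form is linear in the first and antilinear in the second variable (bilinear if $\mathbb{K}=\mathbb{R}$). $\mathcal{V}'$ is the space of continuous antilinear functionals on $\mathcal{V}$ (the usual dual if $\mathbb{K}=\mathbb{R}$), with pairing $\langle L,v\rangle$. An approximating sequence of $\mathcal{V}$ is a sequence $(\mathcal{V}_n)_{n\in\mathbb{N}^*}$ of finite dimensional subspaces of $\mathcal{V}$ such that $\mathrm{dist}(v,\mathcal{V}_n):=\inf\{\|v-\chi\|_{\mathcal{V}}:\chi\in\mathcal{V}_n\}\to0$ as $n\to\infty$ for all $v\in\mathcal{V}$. $\mathcal{X}\hookrightarrow\mathcal{V}'$ means that $\mathcal{X}\subset\mathcal{V}'$ and that there is $c_{\mathcal{X}}>0$ with $\|f\|_{\mathcal{V}'}\le c_{\mathcal{X}}\|f\|_{\mathcal{X}}$ for all $f\in\mathcal{X}$. The space $\mathcal{H}$ is identified with a subspace of $\mathcal{V}'$ via $f\mapsto(v\mapsto\langle f,v\rangle_{\mathcal{H}})$ (Gelfand triple $\mathcal{V}\hookrightarrow\mathcal{H}\hookrightarrow\mathcal{V}'$). The operators $\mathcal{A},\mathcal{A}^*:\mathcal{V}\to\mathcal{V}'$ are given by $\langle\mathcal{A}u,v\rangle=a(u,v)$ and $\langle\mathcal{A}^*u,v\rangle=a^*(u,v):=\overline{a(v,u)}$. Whenever $a$ is a continuous sesquilinear form on the separable Hilbert space $\mathcal{V}$, $(\mathcal{V}_n)_{n\in\mathbb{N}^*}$ is an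 approximating sequence of $\mathcal{V}$, and there is $\beta>0$ such that $\sup_{v\in\mathcal{V}_n,\|v\|_{\mathcal{V}}=1}|a(u,v)|\ge\beta\|u\|_{\mathcal{V}}$ for all $n\in\mathbb{N}^*$ and all $u\in\mathcal{V}_n$, both $\mathcal{A}$ and $\mathcal{A}^*$ are isomorphisms, and for every $L\in\mathcal{V}'$ the continuous problem (find $u\in\mathcal{V}$ with $a(u,v)=\langle L,v\rangle$ for all $v\in\mathcal{V}$) and, for each $n\in\mathbb{N}^*$, the discrete problem (find $u_n\in\mathcal{V}_n$ with $a(u_n,\chi)=\langle L,\chi\rangle$ for all $\chi\in\mathcal{V}_n$) are uniquely solvable. For a Banach space $\mathcal{Z}\hookrightarrow\mathcal{V}'$, $$\gamma_n(\mathcal{Z}):=\sup_{f\in\mathcal{Z},\|f\|_{\mathcal{Z}}=1}\mathrm{dist}(\mathcal{A}^{-1}f,\mathcal{V}_n),\qquad\gamma_n^*(\mathcal{Z}):=\sup_{f\in\mathcal{Z},\|f\|_{\mathcal{Z}}=1}\mathrm{dist}((\mathcal{A}^{*})^{-1}f,\mathcal{V}_n),$$ where the distance is taken in $\mathcal{V}$. *)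

theory Defs
  imports "HOL-Analysis.Analysis"
begin

section \<open>The scalar field: real or complex numbers\<close>

text \<open>One class serves both scalar fields. The norm of a \<open>real_normed_field\<close> is
  multiplicative, and together with the axioms below this leaves only the real numbers with the
  identity and the complex numbers with complex conjugation, up to isometric isomorphism: see
  \<open>real_or_complex_cases\<close>.\<close>

class real_or_complex = real_normed_field +
  fixes conj :: "'a \<Rightarrow> 'a"
  assumes conj_add: "conj (x + y) = conj x + conj y"
    and conj_mult: "conj (x * y) = conj x * conj y"
    and mult_conj_scaleR: "x * conj x = (norm x)\<^sup>2 *\<^sub>R 1"

instantiation real :: real_or_complex
begin
definition conj_real :: "real \<Rightarrow> real" where "conj_real x = x"
instance by standard (simp_all add: conj_real_def power2_eq_square)
end

instantiation complex :: real_or_complex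
begin
definition conj_complex :: "complex \<Rightarrow> complex" where "conj_complex x = cnj x"
instance
  by standard
    (simp_all add: conj_complex_def scaleR_conv_of_real complex_norm_square del: of_real_power)
end

lemma mult_conj: "x * conj x = of_real ((norm (x::'k::real_or_complex))\<^sup>2)"
  by (simp add: mult_conj_scaleR of_real_def)

lemma conj_0 [simp]: "conj (0::'k::real_or_complex) = 0"
  using conj_add[of "0::'k" 0] by simp

lemma conj_of_real [simp]: "conj (of_real r :: 'k::real_or_complex) = of_real r"
proof (cases "r = 0")
  case False
  have "of_real r * conj (of_real r :: 'k) = of_real r * of_real r"
    unfolding mult_conj by (simp add: power2_eq_square)
  with False show ?thesis by simp
qed simp

lemma conj_minus: "conj (- x) = - conj (x::'k::real_or_complex)"
  using conj_add[of x "- x"] by (simp add: add_eq_0_iff)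

lemma conj_diff: "conj (x - y) = conj x - conj (y::'k::real_or_complex)"
  using conj_add[of x "- y"] by (simp add: conj_minus)

lemma norm_conj: "norm (conj x) = norm (x::'k::real_or_complex)"
proof (cases "x = 0")
  case False
  have "norm x * norm (conj x) = norm x * norm x"
    unfolding norm_mult[symmetric] mult_conj by (simp add: norm_mult power2_eq_square)
  with False show ?thesis by simp
qed simp

lemma conj_conj [simp]: "conj (conj x) = (x::'k::real_or_complex)"
proof (cases "x = 0")
  case False
  then have nz: "conj x \<noteq> 0" using norm_conj[of x] by auto
  have "conj x * conj (conj x) = conj x * x"
    using mult_conj[of x] mult_conj[of "conj x"] by (simp add: norm_conj mult.commute)
  with nz show ?thesis by simp
qed simp

lemma add_conj_in_Reals: "(x::'k::real_or_complex) + conj x \<in> \<real>"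
proof -
  have one: "conj (1::'k) = 1" using conj_of_real[of 1] by simp
  have "x + conj x = (x + 1) * conj (x + 1) - x * conj x - 1"
    by (simp add: conj_add one algebra_simps)
  also have "\<dots> = of_real ((norm (x + 1))\<^sup>2 - (norm x)\<^sup>2 - 1)"
    unfolding mult_conj by simp
  finally show ?thesis by (metis Reals_of_real)
qed

lemma conj_fixed_in_Reals: "conj x = x \<Longrightarrow> (x::'k::real_or_complex) \<in> \<real>"
proof -
  assume "conj x = x"
  then have "x = (x + conj x) / 2" by simp
  moreover have "(x + conj x) / 2 \<in> \<real>"
    using add_conj_in_Reals[of x] by (intro Reals_divide) auto
  ultimately show ?thesis by simp
qed

lemma real_or_complex_cases:
  "(range of_real = (UNIV :: 'k::real_or_complex set) \<and> (\<forall>x::'k. conj x = x)) \<or>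
   (\<exists>i::'k. i * i = - 1 \<and> (\<forall>x. \<exists>a b. x = of_real a + of_real b * i
                      \<and> conj x = of_real a - of_real b * i \<and> norm x = sqrt (a\<^sup>2 + b\<^sup>2)))"
proof (cases "\<forall>x::'k. conj x = x")
  case True
  then have "\<And>x::'k. x \<in> \<real>" by (simp add: conj_fixed_in_Reals)
  with True show ?thesis by (auto simp: Reals_def)
next
  case False
  then obtain x0 :: 'k where x0: "conj x0 \<noteq> x0" by auto
  define y where "y = x0 - conj x0"
  have y0: "y \<noteq> 0" and cy: "conj y = - y" using x0 by (auto simp: y_def conj_diff)
  define i where "i = y / of_real (norm y)"
  have y_eq: "y = of_real (norm y) * i" using y0 by (simp add: i_def)
  have ci: "conj i = - i"
  proof -
    have "- y = of_real (norm y) * conj i"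
      using y_eq cy by (metis conj_mult conj_of_real)
    then have "of_real (norm y) * conj i = of_real (norm y) * (- i)"
      using y_eq by simp
    then show ?thesis using y0 by (simp only: mult_cancel_left) simp
  qed
  have ni: "norm i = 1" using y0 by (simp add: i_def norm_divide)
  have ii: "i * i = - 1" using mult_conj[of i] by (simp add: ci ni minus_equation_iff[of "i * i"])
  have "\<exists>a b. x = of_real a + of_real b * i \<and> conj x = of_real a - of_real b * i
          \<and> norm x = sqrt (a\<^sup>2 + b\<^sup>2)" for x
  proof -
    have "(x + conj x) / 2 \<in> \<real>"
      using add_conj_in_Reals[of x] by (intro Reals_divide) auto
    then obtain a where a: "(x + conj x) / 2 = of_real a" by (auto elim: Reals_cases)
    have "- (i * x) + conj (- (i * x)) \<in> \<real>" by (rule add_conj_in_Reals)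
    then have "(- (i * x) + conj (- (i * x))) / 2 \<in> \<real>" by (intro Reals_divide) auto
    then obtain b where "(- (i * x) + conj (- (i * x))) / 2 = of_real b"
      by (auto elim: Reals_cases)
    then have b: "i * (conj x - x) / 2 = of_real b"
      by (simp add: conj_minus conj_mult ci algebra_simps)
    have "of_real b * i = (i * i) * (conj x - x) / 2"
      unfolding b[symmetric] by (simp add: algebra_simps)
    then have bi: "of_real b * i = (x - conj x) / 2"
      by (simp add: ii)
    have x: "x = of_real a + of_real b * i"
      unfolding bi a[symmetric] by (simp add: field_simps)
    have cx: "conj x = of_real a - of_real b * i"
      unfolding bi a[symmetric] by (simp add: field_simps)
    have "x * conj x = of_real a * of_real a - of_real b * of_real b * (i * i)"
      by (subst cx, subst x) (simp add: algebra_simps)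
    then have "of_real ((norm x)\<^sup>2) = (of_real (a\<^sup>2 + b\<^sup>2) :: 'k)"
      unfolding mult_conj ii by (simp add: power2_eq_square)
    then have "(norm x)\<^sup>2 = a\<^sup>2 + b\<^sup>2" unfolding of_real_eq_iff .
    then have "norm x = sqrt (a\<^sup>2 + b\<^sup>2)" by (simp add: real_sqrt_unique)
    with x cx show ?thesis by blast
  qed
  with ii show ?thesis by blast
qed


section \<open>Banach and Hilbert spaces over the scalar field\<close>

text \<open>Completeness is part of the type class \<open>banach\<close>. The type class only knows about real
  scalars; the parameter \<open>scale\<close> is the multiplication by elements of the field \<open>'k\<close>.\<close>

locale banach_space_over = vector_space scale
  for scale :: "'k::real_or_complex \<Rightarrow> 'v::banach \<Rightarrow> 'v" +
  assumes scale_of_real: "scale (of_real r) x = r *\<^sub>R x"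
    and norm_scale: "norm (scale c x) = norm c * norm x"

locale hilbert_space_over = banach_space_over scale
  for scale :: "'k::real_or_complex \<Rightarrow> 'v::banach \<Rightarrow> 'v" +
  fixes ip :: "'v \<Rightarrow> 'v \<Rightarrow> 'k"
  assumes ip_add: "ip (x + y) z = ip x z + ip y z"
    and ip_scale: "ip (scale c x) y = c * ip x y"
    and ip_commute: "ip y x = conj (ip x y)"
    and ip_self: "ip x x = of_real ((norm x)\<^sup>2)"

lemma hilbert_space_over_real:
  "hilbert_space_over scaleR ((\<bullet>) :: 'v::{real_inner,banach} \<Rightarrow> 'v \<Rightarrow> real)"
  by unfold_locales
    (simp_all add: algebra_simps inner_add_left inner_commute conj_real_def power2_norm_eq_inner)

lemma hilbert_space_over_complex:
  "hilbert_space_over (*) (\<lambda>x y::complex. x * cnj y)"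
  by unfold_locales
    (simp_all add: algebra_simps norm_mult scaleR_conv_of_real conj_complex_def complex_norm_square
      del: of_real_power)


section \<open>Forms, functionals and embeddings\<close>

definition sesquilinear_form ::
  "('k::real_or_complex \<Rightarrow> 'v::banach \<Rightarrow> 'v) \<Rightarrow> ('v \<Rightarrow> 'v \<Rightarrow> 'k) \<Rightarrow> bool" where
  "sesquilinear_form scaleV a \<longleftrightarrow>
     (\<forall>u u' v. a (u + u') v = a u v + a u' v) \<and>
     (\<forall>c u v. a (scaleV c u) v = c * a u v) \<and>
     (\<forall>u v v'. a u (v + v') = a u v + a u v') \<and>
     (\<forall>c u v. a u (scaleV c v) = conj c * a u v)"

definition adjoint_form :: "('v \<Rightarrow> 'v \<Rightarrow> 'k::real_or_complex) \<Rightarrow> 'v \<Rightarrow> 'v \<Rightarrow> 'k" where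
  "adjoint_form a u v = conj (a v u)"

definition antidual :: "('k::real_or_complex \<Rightarrow> 'v::banach \<Rightarrow> 'v) \<Rightarrow> ('v \<Rightarrow> 'k) set" where
  "antidual scaleV = {f. (\<forall>v w. f (v + w) = f v + f w) \<and>
                        (\<forall>c v. f (scaleV c v) = conj c * f v) \<and>
                        continuous_on UNIV f}"

text \<open>A Banach space \<open>\<X> \<subseteq> \<V>'\<close> with its own norm is a Banach space type together with
  the inclusion map \<open>\<iota>\<close>, so that \<open>\<iota> f v\<close> is the pairing of \<open>f \<in> \<X>\<close> with \<open>v\<close>. The norm of \<open>\<V>'\<close>
  is \<open>onorm\<close>, which makes sense here since antilinear maps are real-linear.\<close>

definition embedded_in_antidual ::
  "('k::real_or_complex \<Rightarrow> 'v::banach \<Rightarrow> 'v) \<Rightarrow> ('k \<Rightarrow> 'x::banach \<Rightarrow> 'x) \<Rightarrow> ('x \<Rightarrow> 'v \<Rightarrow> 'k) \<Rightarrow> bool"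
  where
  "embedded_in_antidual scaleV scaleX \<iota> \<longleftrightarrow>
     range \<iota> \<subseteq> antidual scaleV \<and>
     (\<forall>f g v. \<iota> (f + g) v = \<iota> f v + \<iota> g v) \<and>
     (\<forall>c f v. \<iota> (scaleX c f) v = c * \<iota> f v) \<and>
     inj \<iota> \<and>
     (\<exists>c>0. \<forall>f. onorm (\<iota> f) \<le> c * norm f)"

definition densely_embedded ::
  "('k::real_or_complex \<Rightarrow> 'v::banach \<Rightarrow> 'v) \<Rightarrow> ('k \<Rightarrow> 'h::banach \<Rightarrow> 'h) \<Rightarrow> ('v \<Rightarrow> 'h) \<Rightarrow> bool"
  where
  "densely_embedded scaleV scaleH j \<longleftrightarrow>
     Vector_Spaces.linear scaleV scaleH j \<and> inj j \<and>
     (\<exists>c>0. \<forall>v. norm (j v) \<le> c * norm v) \<and>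
     closure (range j) = UNIV"

text \<open>The identification of \<open>\<H>\<close> with a subspace of \<open>\<V>'\<close> in the Gelfand triple, for the
  embedding \<open>j\<close> of \<open>\<V>\<close> into \<open>\<H>\<close>.\<close>

definition gelfand_embedding :: "('h \<Rightarrow> 'h \<Rightarrow> 'k) \<Rightarrow> ('v \<Rightarrow> 'h) \<Rightarrow> 'h \<Rightarrow> 'v \<Rightarrow> 'k" where
  "gelfand_embedding ipH j f v = ipH f (j v)"


section \<open>Galerkin approximation\<close>

text \<open>The sequence is indexed by the positive integers; the value at \<open>0\<close> is irrelevant.\<close>

definition approximating_sequence ::
  "('k::real_or_complex \<Rightarrow> 'v::banach \<Rightarrow> 'v) \<Rightarrow> (nat \<Rightarrow> 'v set) \<Rightarrow> bool" where
  "approximating_sequence scaleV W \<longleftrightarrow>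
     (\<forall>n\<ge>1. module.subspace scaleV (W n) \<and> (\<exists>B. finite B \<and> module.span scaleV B = W n)) \<and>
     (\<forall>v. (\<lambda>n. infdist v (W n)) \<longlonglongrightarrow> 0)"

text \<open>Supremum of a bounded set of nonnegative reals. Inserting \<open>0\<close> only matters for the empty
  set (unit spheres of zero spaces), where \<open>Sup {}\<close> would be an unspecified real number.\<close>

definition sup_nonneg :: "real set \<Rightarrow> real" where
  "sup_nonneg S = Sup (insert 0 S)"

text \<open>The operator of \<open>\<V>\<close> into \<open>\<V>'\<close> given by a form \<open>a\<close> is the curried function \<open>a\<close> itself, since
  \<open>a u\<close> is the functional that maps \<open>v\<close> to \<open>a u v\<close>; hence \<open>inv a\<close> is its inverse. For \<open>\<gamma>\<^sub>n\<close> take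
  the form \<open>a\<close> and for \<open>\<gamma>\<^sub>n\<^sup>*\<close> its adjoint form.\<close>

definition gamma ::
  "('v::banach \<Rightarrow> 'v \<Rightarrow> 'k::real_or_complex) \<Rightarrow> ('z::banach \<Rightarrow> 'v \<Rightarrow> 'k) \<Rightarrow> 'v set \<Rightarrow> real" where
  "gamma a \<iota> W = sup_nonneg {infdist (inv a (\<iota> f)) W |f. norm f = 1}"

end

theory Submission
  imports Defs
begin

text \<open>The estimate is an Aubin--Nitsche duality argument. Let \<open>e\<close> be the error \<open>u - un n\<close>; it satisfies
  \<open>a e v = 0\<close> for all \<open>v\<close> in the discrete space. For the datum \<open>f = j e / norm (j e)\<close> let \<open>w\<close> solve
  the adjoint problem. Then \<open>norm (j e)\<close> equals the modulus of \<open>a e w\<close>, and by orthogonality \<open>w\<close>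
  may be replaced by its difference to the discrete space. So \<open>norm (j e)\<close> is at most
  \<open>M * norm e\<close> times the distance of \<open>w\<close> from the discrete space, which is at most the adjoint
  \<open>gamma\<close> (\<open>functional_of_Galerkin_error_le\<close>).

  It remains to bound \<open>norm e\<close> by \<open>M / \<beta>\<close> times the distance of \<open>u\<close> from the discrete space
  (\<open>Galerkin_error_le\<close>), and hence by \<open>M / \<beta>\<close> times \<open>gamma\<close> times the norm of the datum. The constant
  \<open>M / \<beta>\<close> instead of \<open>1 + M / \<beta>\<close> uses the Hilbert space structure: complementary oblique
  projections have equal norms, by an exchange of the lengths of two vectors
  (\<open>norm_add_swap_lengths\<close>).

  Both steps need the operators of the form and of its adjoint to be bijective onto the antidual
  space with bounded inverse; otherwise the values of \<open>inv\<close> and of the suprema in \<open>gamma\<close> would be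
  meaningless. Stability of the discrete problems passes to the limit
  (\<open>inf_sup_form_of_discrete_inf_sup\<close>), where solvability in finite dimension supplies injectivity
  of the adjoint. A closed range argument based on orthogonal projection and the Riesz
  representation then yields surjectivity, and the adjoint inherits the inf-sup condition with the
  same constant.\<close>

section \<open>Sesquilinear forms and antilinear functionals\<close>

context
  fixes scale :: "'k::real_or_complex \<Rightarrow> 'v::banach \<Rightarrow> 'v" and a :: "'v \<Rightarrow> 'v \<Rightarrow> 'k"
  assumes sesq: "sesquilinear_form scale a"
begin

lemma form_add_left: "a (u + u') v = a u v + a u' v"
  and form_scale_left: "a (scale c u) v = c * a u v"
  and form_add_right: "a u (v + v') = a u v + a u v'"
  and form_scale_right: "a u (scale c v) = conj c * a u v"
  using sesq by (simp_all add: sesquilinear_form_def)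

lemma form_zero_left: "a 0 v = 0"
  using form_add_left[of 0 0 v] by simp

lemma form_zero_right: "a u 0 = 0"
  using form_add_right[of u 0 0] by simp

lemma form_diff_left: "a (u - u') v = a u v - a u' v"
  using form_add_left[of "u - u'" u' v] by (simp add: algebra_simps)

lemma form_diff_right: "a u (v - v') = a u v - a u v'"
  using form_add_right[of u "v - v'" v'] by (simp add: algebra_simps)

lemma sesquilinear_adjoint_form: "sesquilinear_form scale (adjoint_form a)"
  by (simp add: sesquilinear_form_def adjoint_form_def form_add_left form_add_right
      form_scale_left form_scale_right conj_add conj_mult)

lemma form_in_antidual:
  assumes "\<And>u v. norm (a u v) \<le> M * norm u * norm v"
    and "\<And>r x. scale (of_real r) x = r *\<^sub>R x"
  shows "a u \<in> antidual scale"
proof -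
  have "bounded_linear (a u)"
  proof (rule bounded_linear_intro)
    show "a u (r *\<^sub>R x) = r *\<^sub>R a u x" for r x
      using form_scale_right[of u "of_real r" x] assms(2) by (simp add: scaleR_conv_of_real)
    show "norm (a u x) \<le> norm x * (M * norm u)" for x
      using assms(1)[of u x] by (simp add: mult.commute)
  qed (rule form_add_right)
  then show ?thesis
    unfolding antidual_def
    by (auto simp: form_add_right form_scale_right
        intro: bounded_linear.continuous_on continuous_on_id)
qed

end

lemma adjoint_adjoint_form [simp]: "adjoint_form (adjoint_form a) = a"
  by (simp add: adjoint_form_def fun_eq_iff)

context banach_space_over
begin

text \<open>Continuity at \<open>0\<close> and homogeneity give a bound. The norm of the dual space is \<open>onorm\<close>, whose
  characteristic estimate presupposes a bounded real-linear map.\<close>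

lemma bounded_linear_antidual:
  assumes "g \<in> antidual scale"
  shows "bounded_linear g"
proof -
  have add: "g (v + w) = g v + g w" for v w using assms by (simp add: antidual_def)
  have sc: "g (r *\<^sub>R v) = r *\<^sub>R g v" for r v
    using assms scale_of_real[of r v, symmetric] by (simp add: antidual_def scaleR_conv_of_real)
  have cont: "continuous_on UNIV g" using assms by (simp add: antidual_def)
  have g0: "g 0 = 0" using add[of 0 0] by simp
  obtain d where d: "d > 0" "\<And>x. norm x < d \<Longrightarrow> norm (g x) < 1"
    using cont g0 unfolding continuous_on_iff
    by (metis UNIV_I dist_0_norm dist_commute zero_less_one)
  show ?thesis
  proof (rule bounded_linear_intro[OF add sc])
    fix x
    show "norm (g x) \<le> norm x * (2 / d)"
    proof (cases "x = 0")
      case False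
      define r where "r = d / (2 * norm x)"
      have r: "r > 0" using d False by (simp add: r_def)
      have "norm (r *\<^sub>R x) < d" using d False by (simp add: r_def)
      then have "norm (g (r *\<^sub>R x)) < 1" by (rule d)
      then have "r * norm (g x) < 1" using r by (simp add: sc)
      then have "norm (g x) \<le> 1 / r" using r by (simp add: field_simps)
      then show ?thesis using False d by (simp add: r_def field_simps)
    qed (simp add: g0)
  qed
qed

lemma scaleR_in_subspace: "subspace S \<Longrightarrow> x \<in> S \<Longrightarrow> r *\<^sub>R x \<in> S"
  using subspace_scale[of S x "of_real r"] by (simp add: scale_of_real)

end

section \<open>Orthogonal projection and Riesz representation\<close>

context hilbert_space_over
begin

lemma ip_sesquilinear: "sesquilinear_form scale ip"
proof -
  have "ip x (y + z) = ip x y + ip x z" for x y z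
    by (metis ip_commute ip_add conj_add)
  moreover have "ip x (scale c y) = conj c * ip x y" for x y c
    by (metis ip_commute ip_scale conj_mult)
  ultimately show ?thesis by (simp add: sesquilinear_form_def ip_add ip_scale)
qed

lemmas ip_simps = form_add_left[OF ip_sesquilinear] form_add_right[OF ip_sesquilinear]
  form_diff_left[OF ip_sesquilinear] form_diff_right[OF ip_sesquilinear]
  form_scale_left[OF ip_sesquilinear] form_scale_right[OF ip_sesquilinear]
  form_zero_left[OF ip_sesquilinear] form_zero_right[OF ip_sesquilinear]

lemma ip_scaleR_left: "ip (r *\<^sub>R x) y = of_real r * ip x y"
  and ip_scaleR_right: "ip x (r *\<^sub>R y) = of_real r * ip x y"
  by (simp_all add: scale_of_real[symmetric] ip_simps)

lemma norm_add_squared: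
  "of_real ((norm (x + y))\<^sup>2) = of_real ((norm x)\<^sup>2) + of_real ((norm y)\<^sup>2) + ip x y + ip y x"
  unfolding ip_self[symmetric] by (simp add: ip_simps)

lemma parallelogram_law:
  "(norm (x + y :: 'v))\<^sup>2 + (norm (x - y))\<^sup>2 = 2 * (norm x)\<^sup>2 + 2 * (norm y)\<^sup>2"
proof -
  have "of_real ((norm (x + y))\<^sup>2 + (norm (x - y))\<^sup>2)
      = (of_real (2 * (norm x)\<^sup>2 + 2 * (norm y)\<^sup>2) :: 'k)"
    unfolding of_real_add of_real_mult of_real_numeral ip_self[symmetric]
    by (simp add: ip_simps)
  then show ?thesis unfolding of_real_eq_iff .
qed

text \<open>Pythagoras for the component of \<open>x\<close> orthogonal to \<open>y\<close>. Nonnegativity of the left side is the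
  Cauchy--Schwarz inequality; minimality of the left side characterises orthogonality.\<close>

lemma norm_minus_component_squared:
  assumes "y \<noteq> 0"
  shows "(norm (x - scale (ip x y / of_real ((norm y)\<^sup>2)) y))\<^sup>2
    = (norm x)\<^sup>2 - (norm (ip x y))\<^sup>2 / (norm y)\<^sup>2"
proof -
  define n where "n = (norm y)\<^sup>2"
  have n: "n \<noteq> 0" using assms by (simp add: n_def)
  define c where "c = ip x y / of_real n"
  have cn: "c * of_real n = ip x y" using n by (simp add: c_def)
  have yy: "ip y y = of_real n" by (simp add: ip_self n_def)
  have yx: "ip y x = conj c * of_real n"
    by (simp add: ip_commute[of y x] cn[symmetric] conj_mult)
  have xy: "(norm c)\<^sup>2 * n = (norm (ip x y))\<^sup>2 / n"
    using n by (simp add: c_def norm_divide power_divide power2_eq_square)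
  have "of_real ((norm (x - scale c y))\<^sup>2)
      = ip x x - conj c * (c * of_real n) - c * (conj c * of_real n) + c * conj c * of_real n"
    unfolding ip_self[symmetric] cn yx[symmetric]
    by (simp add: ip_simps yy algebra_simps)
  also have "\<dots> = ip x x - c * conj c * of_real n" by (simp add: algebra_simps)
  also have "\<dots> = of_real ((norm x)\<^sup>2 - (norm c)\<^sup>2 * n)"
    unfolding mult_conj ip_self by simp
  finally show ?thesis unfolding of_real_eq_iff xy unfolding c_def n_def .
qed

lemma Cauchy_Schwarz: "norm (ip x y) \<le> norm x * norm y"
proof (cases "y = 0")
  case False
  then have "(norm (ip x y))\<^sup>2 / (norm y)\<^sup>2 \<le> (norm x)\<^sup>2"
    using norm_minus_component_squared[of y x] zero_le_power2 by (metis diff_ge_0_iff_ge)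
  then have "(norm (ip x y))\<^sup>2 \<le> (norm x * norm y)\<^sup>2"
    using False by (simp add: field_simps power_mult_distrib)
  then show ?thesis by (rule power2_le_imp_le) simp
qed (simp add: ip_simps)

lemma ip_in_antidual: "ip x \<in> antidual scale"
  by (rule form_in_antidual[OF ip_sesquilinear, of 1]) (simp_all add: Cauchy_Schwarz scale_of_real)

text \<open>A minimising sequence for the distance of \<open>x\<close> to \<open>S\<close> is Cauchy by the parallelogram law, and
  its limit is the foot of the perpendicular: any nonzero component of \<open>x - s\<close> along an element
  of \<open>S\<close> could be subtracted to come closer.\<close>

lemma projection_onto_closed_subspace:
  assumes "closed S" and sub: "subspace S"
  obtains s where "s \<in> S" "\<And>y. y \<in> S \<Longrightarrow> ip (x - s) y = 0"
proof -
  define d where "d = infdist x S"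
  have d0: "d \<ge> 0" by (simp add: d_def infdist_nonneg)
  have ne: "S \<noteq> {}" using subspace_0[OF sub] by auto
  have "\<exists>s\<in>S. dist x s < d + 1 / Suc k" for k
  proof (rule ccontr)
    assume "\<not> ?thesis"
    then have "d + 1 / Suc k \<le> d"
      unfolding d_def infdist_notempty[OF ne] by (intro cINF_greatest[OF ne]) force
    then show False by simp
  qed
  then obtain s where s: "\<And>k. s k \<in> S" "\<And>k. dist x (s k) < d + 1 / Suc k" by metis
  have low: "d \<le> norm (x - y)" if "y \<in> S" for y
    using infdist_le[OF that, of x] by (simp add: d_def dist_norm)
  \<comment> \<open>The midpoint of two points of \<open>S\<close> lies in \<open>S\<close>, so it is no closer to \<open>x\<close> than \<open>d\<close>.\<close>
  have par: "(norm (y - z))\<^sup>2 \<le> 2 * (norm (x - y))\<^sup>2 + 2 * (norm (x - z))\<^sup>2 - 4 * d\<^sup>2"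
    if "y \<in> S" "z \<in> S" for y z
  proof -
    have "(1/2) *\<^sub>R (y + z) \<in> S" by (intro scaleR_in_subspace sub subspace_add that)
    from low[OF this] have "2 * d \<le> 2 * norm (x - (1/2) *\<^sub>R (y + z))" by simp
    also have "\<dots> = norm (2 *\<^sub>R (x - (1/2) *\<^sub>R (y + z)))" by simp
    also have "2 *\<^sub>R (x - (1/2) *\<^sub>R (y + z)) = (x - y) + (x - z)"
      by (simp add: algebra_simps scaleR_2)
    finally have "(2 * d)\<^sup>2 \<le> (norm ((x - y) + (x - z)))\<^sup>2" using d0 by (intro power_mono) auto
    then show ?thesis using parallelogram_law[of "x - y" "x - z"]
      by (simp add: norm_minus_commute[of z y])
  qed
  \<comment> \<open>Twice the excess of the squared distance that the choice of \<open>s k\<close> allows: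
    \<open>e k = 2 * (d + 1 / Suc k)\<^sup>2 - 2 * d\<^sup>2\<close>.\<close>
  define e where "e k = 4 * d / Suc k + 2 / (Suc k)\<^sup>2" for k :: nat
  have near: "2 * (norm (x - s k))\<^sup>2 - 2 * d\<^sup>2 \<le> e k" for k
  proof -
    have "(norm (x - s k))\<^sup>2 \<le> (d + 1 / Suc k)\<^sup>2"
      using s(2)[of k] by (intro power_mono) (auto simp: dist_norm)
    then show ?thesis by (simp add: e_def power2_sum power_divide)
  qed
  have e_lim: "e \<longlonglongrightarrow> 0"
  proof -
    have r: "(\<lambda>k. inverse (real (Suc k))) \<longlonglongrightarrow> 0" by (rule LIMSEQ_inverse_real_of_nat)
    have "(\<lambda>k. 4 * d * inverse (real (Suc k)) + 2 * (inverse (real (Suc k)))\<^sup>2) \<longlonglongrightarrow> 4 * d * 0 + 2 * 0\<^sup>2"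
      by (intro tendsto_intros r)
    then show ?thesis
      unfolding e_def by (simp add: divide_inverse power_inverse del: of_nat_Suc)
  qed
  have "Cauchy s"
  proof (rule metric_CauchyI)
    fix \<epsilon> :: real assume \<epsilon>: "\<epsilon> > 0"
    have "eventually (\<lambda>k. e k < \<epsilon>\<^sup>2 / 2) sequentially"
      using order_tendstoD(2)[OF e_lim, of "\<epsilon>\<^sup>2 / 2"] \<epsilon> by simp
    then obtain N where N: "\<And>k. k \<ge> N \<Longrightarrow> e k < \<epsilon>\<^sup>2 / 2"
      unfolding eventually_sequentially by blast
    have "dist (s m) (s n) < \<epsilon>" if "m \<ge> N" "n \<ge> N" for m n
    proof -
      have "(norm (s m - s n))\<^sup>2 \<le> e m + e n"
        using par[OF s(1) s(1), of m n] near[of m] near[of n] by simp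
      also have "\<dots> < \<epsilon>\<^sup>2" using N that by (smt (verit) field_sum_of_halves)
      finally show ?thesis using \<epsilon> by (simp add: dist_norm power_less_imp_less_base)
    qed
    then show "\<exists>N. \<forall>m\<ge>N. \<forall>n\<ge>N. dist (s m) (s n) < \<epsilon>" by blast
  qed
  then obtain t where t: "s \<longlonglongrightarrow> t" using Cauchy_convergent convergent_def by blast
  have tS: "t \<in> S" using closed_sequentially[OF \<open>closed S\<close> _ t] s(1) by blast
  have "(\<lambda>k. dist x (s k)) \<longlonglongrightarrow> dist x t" by (intro tendsto_intros t)
  moreover have "(\<lambda>k. d + inverse (real (Suc k))) \<longlonglongrightarrow> d + 0"
    by (intro tendsto_intros LIMSEQ_inverse_real_of_nat)
  ultimately have "dist x t \<le> d + 0"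
    using s(2) by (intro LIMSEQ_le) (auto simp: divide_inverse less_imp_le)
  then have xt: "norm (x - t) = d" using low[OF tS] by (simp add: dist_norm)
  have "ip (x - t) y = 0" if "y \<in> S" for y
  proof (cases "y = 0")
    case False
    define c where "c = ip (x - t) y / of_real ((norm y)\<^sup>2)"
    have "t + scale c y \<in> S" by (intro subspace_add subspace_scale sub tS that)
    from low[OF this] have "d\<^sup>2 \<le> (norm (x - t - scale c y))\<^sup>2"
      using d0 by (intro power_mono) (simp_all add: diff_diff_eq)
    then have "(norm (ip (x - t) y))\<^sup>2 / (norm y)\<^sup>2 \<le> 0"
      using norm_minus_component_squared[OF False, of "x - t"] by (simp add: c_def xt)
    then show ?thesis using False by (simp add: divide_le_0_iff)
  qed (simp add: ip_simps)
  with tS show thesis by (rule that)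
qed

text \<open>The kernel of a nonzero functional is a closed subspace, and a nonzero \<open>z\<close> orthogonal to it
  represents the functional up to a scalar.\<close>

lemma Riesz_representation:
  assumes g: "g \<in> antidual scale"
  obtains r where "\<And>v. g v = ip r v"
proof (cases "\<forall>v. g v = 0")
  case True
  then show thesis using that[of 0] by (simp add: ip_simps)
next
  case False
  then obtain x where x: "g x \<noteq> 0" by auto
  have add: "g (v + w) = g v + g w" and sc: "g (scale c v) = conj c * g v" for v w c
    using g by (simp_all add: antidual_def)
  have g0: "g 0 = 0" using add[of 0 0] by simp
  have diff: "g (v - w) = g v - g w" for v w using add[of "v - w" w] by (simp add: algebra_simps)
  have "closed {v \<in> UNIV. g v = 0}"
    using g by (intro continuous_closed_preimage_constant) (auto simp: antidual_def)
  moreover have "subspace {v \<in> UNIV. g v = 0}"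
    unfolding subspace_def by (simp add: add sc g0)
  ultimately obtain s where s: "g s = 0" "\<And>y. g y = 0 \<Longrightarrow> ip (x - s) y = 0"
    using projection_onto_closed_subspace[of "{v \<in> UNIV. g v = 0}" x] by auto
  define z where "z = x - s"
  have gz: "g z \<noteq> 0" using x s(1) by (simp add: z_def diff)
  then have zn: "norm z \<noteq> 0" using g0 by auto
  \<comment> \<open>Splitting \<open>v\<close> into a multiple of \<open>z\<close> and an element of the kernel of \<open>g\<close>.\<close>
  have "g v = ip (scale (g z / of_real ((norm z)\<^sup>2)) z) v" for v
  proof -
    define c where "c = conj (g v / g z)"
    have "g (v - scale c z) = 0" using gz by (simp add: diff sc c_def)
    then have "ip z (v - scale c z) = 0" unfolding z_def by (rule s(2))
    then have "ip z v = conj c * of_real ((norm z)\<^sup>2)" by (simp add: ip_simps ip_self)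
    then show ?thesis using gz zn by (simp add: ip_simps c_def)
  qed
  then show thesis by (rule that)
qed

text \<open>The norm of a sum depends only on the two lengths and on the inner product. Exchanging the
  lengths of \<open>p\<close> and \<open>q\<close> while keeping their directions preserves the inner product.\<close>

lemma norm_add_swap_lengths:
  assumes "p \<noteq> 0" "(q::'v) \<noteq> 0"
  shows "norm ((norm q / norm p) *\<^sub>R p + (norm p / norm q) *\<^sub>R q) = norm (p + q)"
proof -
  have c: "of_real (norm q / norm p) * (of_real (norm p / norm q) * w) = (w::'k)" for w
    using assms by (simp add: field_simps)
  have c': "of_real (norm p / norm q) * (of_real (norm q / norm p) * w) = (w::'k)" for w
    using assms by (simp add: field_simps)
  have "of_real ((norm ((norm q / norm p) *\<^sub>R p + (norm p / norm q) *\<^sub>R q))\<^sup>2)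
      = (of_real ((norm (p + q))\<^sup>2) :: 'k)"
    unfolding norm_add_squared ip_scaleR_left ip_scaleR_right c c' using assms by (simp del: of_real_power)
  then have "(norm ((norm q / norm p) *\<^sub>R p + (norm p / norm q) *\<^sub>R q))\<^sup>2 = (norm (p + q))\<^sup>2"
    unfolding of_real_eq_iff .
  then show ?thesis by (simp add: power2_eq_iff_nonneg)
qed

end

section \<open>Unique solvability of inf-sup stable problems\<close>

context banach_space_over
begin

lemma antilinear_eq_on_span:
  assumes f: "f \<in> antidual scale" and g: "g \<in> antidual scale"
    and eq: "\<And>b. b \<in> B \<Longrightarrow> f b = g b" and v: "v \<in> span B"
  shows "f v = g v"
proof -
  have zero: "h 0 = 0" if "h \<in> antidual scale" for h
    using that bounded_linear_antidual linear_simps(3) by blast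
  have "subspace {v. f v = g v}"
    using f g zero[OF f] zero[OF g] by (auto simp: subspace_def antidual_def)
  then have "span B \<subseteq> {v. f v = g v}" using eq by (intro span_minimal) auto
  then show ?thesis using v by auto
qed

text \<open>In finite dimension uniqueness implies existence. For a basis \<open>C\<close>, the linear map
  \<open>\<Phi> w = (\<Sum>b\<in>C. scale (a w b) b)\<close> of \<open>span C\<close> into itself encodes the functional \<open>a w\<close> by its values
  on the basis. It is injective since \<open>a\<close> is nondegenerate, hence onto by counting independent
  vectors, and a preimage of \<open>\<Sum>b\<in>C. scale (g b) b\<close> solves the problem.\<close>

lemma finite_dimensional_solvable:
  assumes sesq: "sesquilinear_form scale a" and anti: "\<And>w. a w \<in> antidual scale"
    and fin: "finite B"
    and nondegenerate: "\<And>w. w \<in> span B \<Longrightarrow> (\<And>v. v \<in> span B \<Longrightarrow> a w v = 0) \<Longrightarrow> w = 0"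
    and g: "g \<in> antidual scale"
  obtains w where "w \<in> span B" "\<And>v. v \<in> span B \<Longrightarrow> a w v = g v"
proof -
  obtain C where C: "C \<subseteq> B" "independent C" "B \<subseteq> span C"
    using maximal_independent_subset[of B] by blast
  have spanC: "span C = span B"
    by (metis C(1,3) span_mono span_minimal subspace_span subset_antisym)
  have finC: "finite C" using C(1) fin by (rule finite_subset)
  define \<Phi> where "\<Phi> w = (\<Sum>b\<in>C. scale (a w b) b)" for w
  interpret \<Phi>: Vector_Spaces.linear scale scale \<Phi>
    by unfold_locales
      (simp_all add: \<Phi>_def form_add_left[OF sesq] form_scale_left[OF sesq] scale_left_distrib
        sum.distrib scale_sum_right)
  have zero_antidual: "(\<lambda>_. 0) \<in> antidual scale" by (simp add: antidual_def)
  have coeff: "\<forall>b\<in>C. c b = d b"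
    if "(\<Sum>b\<in>C. scale (c b) b) = (\<Sum>b\<in>C. scale (d b) b)" for c d
  proof -
    have "(\<Sum>b\<in>C. scale (c b - d b) b) = 0"
      using that by (simp add: scale_left_diff_distrib sum_subtractf)
    then show ?thesis using independentD[OF C(2) finC order_refl] by fastforce
  qed
  have inj: "inj_on \<Phi> (span C)"
    unfolding \<Phi>.inj_on_iff_eq_0[OF subspace_span]
  proof (intro ballI impI)
    fix w assume w: "w \<in> span C" and "\<Phi> w = 0"
    then have "\<forall>b\<in>C. a w b = 0" using coeff[of "a w" "\<lambda>_. 0"] by (simp add: \<Phi>_def)
    then have "a w v = 0" if "v \<in> span C" for v
      using antilinear_eq_on_span[OF anti zero_antidual _ that] by simp
    with w show "w = 0" using nondegenerate spanC by simp
  qed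
  then have ind: "independent (\<Phi> ` C)" and card: "card (\<Phi> ` C) = card C"
    using \<Phi>.independent_injective_image[OF C(2) inj]
      card_image[OF inj_on_subset[OF inj span_superset]] by auto
  have image: "\<Phi> w \<in> span C" for w
    unfolding \<Phi>_def by (intro span_sum span_scale span_base)
  have onto: "t \<in> span (\<Phi> ` C)" if t: "t \<in> span C" for t
  proof (rule ccontr)
    assume nt: "t \<notin> span (\<Phi> ` C)"
    then have "independent (insert t (\<Phi> ` C))" using ind by (rule independent_insertI)
    moreover have "insert t (\<Phi> ` C) \<subseteq> span C" using t image by auto
    ultimately have "card (insert t (\<Phi> ` C)) \<le> card C" using independent_span_bound[OF finC] by blast
    moreover have "t \<notin> \<Phi> ` C" using nt span_base by blast
    ultimately show False using card finC by simp
  qed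
  have "(\<Sum>b\<in>C. scale (g b) b) \<in> span C" by (intro span_sum span_scale span_base)
  then have "(\<Sum>b\<in>C. scale (g b) b) \<in> \<Phi> ` span C" using onto \<Phi>.span_image[of C] by auto
  then obtain w where w: "w \<in> span C" "(\<Sum>b\<in>C. scale (g b) b) = \<Phi> w" by auto
  then have "\<And>b. b \<in> C \<Longrightarrow> a w b = g b" using coeff[of g "a w"] by (simp add: \<Phi>_def)
  then have "\<And>v. v \<in> span C \<Longrightarrow> a w v = g v" using antilinear_eq_on_span[OF anti g] by blast
  with w(1) show thesis using that spanC by simp
qed

end

text \<open>The inf-sup condition is stated through upper bounds \<open>K\<close> of the functional \<open>a w\<close> instead of a
  supremum over the unit sphere, which may be empty. Together with nondegeneracy in the second
  argument it makes the operator an isomorphism onto the antidual space.\<close>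

locale inf_sup_form = hilbert_space_over scale ip
  for scale :: "'k::real_or_complex \<Rightarrow> 'v::banach \<Rightarrow> 'v" and ip +
  fixes a :: "'v \<Rightarrow> 'v \<Rightarrow> 'k" and M \<beta> :: real
  assumes sesq: "sesquilinear_form scale a"
    and bound: "norm (a w v) \<le> M * norm w * norm v"
    and M_pos: "M > 0" and beta_pos: "\<beta> > 0"
    and inf_sup: "0 \<le> K \<Longrightarrow> (\<And>v. norm (a w v) \<le> K * norm v) \<Longrightarrow> \<beta> * norm w \<le> K"
    and nondegenerate: "(\<And>w. a w v = 0) \<Longrightarrow> v = 0"
begin

lemmas form_simps = form_add_left[OF sesq] form_add_right[OF sesq]
  form_diff_left[OF sesq] form_diff_right[OF sesq]
  form_scale_left[OF sesq] form_scale_right[OF sesq]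
  form_zero_left[OF sesq] form_zero_right[OF sesq]

lemma form_antidual: "a w \<in> antidual scale"
  using bound by (rule form_in_antidual[OF sesq]) (rule scale_of_real)

lemma bounded_bilinear_real: "bounded_bilinear a"
proof
  show "a (r *\<^sub>R x) y = r *\<^sub>R a x y" "a x (r *\<^sub>R y) = r *\<^sub>R a x y" for r x y
    by (simp_all only: scale_of_real[symmetric] form_simps conj_of_real scaleR_conv_of_real)
  show "\<exists>K. \<forall>x y. norm (a x y) \<le> norm x * norm y * K"
    using bound by (intro exI[of _ M]) (simp add: mult_ac)
qed (simp_all add: form_simps)

lemma beta_norm_le: "\<beta> * norm (w::'v) \<le> M * norm w"
  by (rule inf_sup) (use M_pos bound in auto)

text \<open>The inf-sup condition makes the range closed, as preimages of a Cauchy sequence are Cauchy;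
  nondegeneracy makes its orthogonal complement trivial.\<close>

theorem surjective:
  assumes g: "g \<in> antidual scale"
  obtains w where "a w = g"
proof -
  \<comment> \<open>The Riesz representers of the functionals in the range of the operator.\<close>
  define R where "R = {r. \<exists>w. \<forall>v. a w v = ip r v}"
  have sub: "subspace R"
    unfolding subspace_def
  proof (intro conjI ballI allI)
    show "0 \<in> R" unfolding R_def by (auto intro!: exI[of _ 0] simp: form_simps ip_simps)
    fix x y c assume "x \<in> R"
    then obtain w where w: "\<forall>v. a w v = ip x v" by (auto simp: R_def)
    then have "\<forall>v. a (scale c w) v = ip (scale c x) v" by (simp add: form_simps ip_simps)
    then show "scale c x \<in> R" by (auto simp: R_def)
    assume "y \<in> R"
    then obtain w' where "\<forall>v. a w' v = ip y v" by (auto simp: R_def)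
    with w have "\<forall>v. a (w + w') v = ip (x + y) v" by (simp add: form_simps ip_simps)
    then show "x + y \<in> R" by (auto simp: R_def)
  qed
  have "closed R"
    unfolding closed_sequential_limits
  proof (intro allI impI, elim conjE)
    fix r l assume "\<forall>k. r k \<in> R" and lim: "r \<longlonglongrightarrow> l"
    then obtain w where w: "\<And>k v. a (w k) v = ip (r k) v" unfolding R_def by simp metis
    have stable: "\<beta> * norm (w m - w n) \<le> norm (r m - r n)" for m n
    proof (rule inf_sup)
      show "norm (a (w m - w n) v) \<le> norm (r m - r n) * norm v" for v
        using Cauchy_Schwarz[of "r m - r n" v] by (simp add: form_simps ip_simps w)
    qed simp
    have "Cauchy w"
    proof (rule metric_CauchyI)
      fix e :: real assume "e > 0"
      then have "\<beta> * e > 0" using beta_pos by simp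
      then obtain N where N: "\<And>m n. m \<ge> N \<Longrightarrow> n \<ge> N \<Longrightarrow> dist (r m) (r n) < \<beta> * e"
        using LIMSEQ_imp_Cauchy[OF lim] unfolding Cauchy_def by blast
      have "dist (w m) (w n) < e" if "m \<ge> N" "n \<ge> N" for m n
      proof -
        have "\<beta> * dist (w m) (w n) < \<beta> * e"
          using stable[of m n] N[OF that] by (simp add: dist_norm)
        then show ?thesis using beta_pos by simp
      qed
      then show "\<exists>N. \<forall>m\<ge>N. \<forall>n\<ge>N. dist (w m) (w n) < e" by blast
    qed
    then obtain w' where w': "w \<longlonglongrightarrow> w'" using Cauchy_convergent convergent_def by blast
    have "a w' v = ip l v" for v
    proof (rule LIMSEQ_unique)
      show "(\<lambda>k. a (w k) v) \<longlonglongrightarrow> a w' v"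
        by (intro bounded_bilinear.tendsto[OF bounded_bilinear_real] w' tendsto_const)
      have "(\<lambda>k. norm (r k - l) * norm v) \<longlonglongrightarrow> 0 * norm v"
        by (intro tendsto_intros tendsto_norm_zero LIM_zero lim)
      then have "(\<lambda>k. ip (r k - l) v) \<longlonglongrightarrow> 0"
        by (intro Lim_null_comparison[OF always_eventually[OF allI[OF Cauchy_Schwarz]]]) simp
      then show "(\<lambda>k. a (w k) v) \<longlonglongrightarrow> ip l v"
        unfolding w ip_simps by (rule LIM_zero_cancel)
    qed
    then show "l \<in> R" by (auto simp: R_def)
  qed
  obtain r where r: "\<And>v. g v = ip r v" using Riesz_representation[OF g] by blast
  obtain s where s: "s \<in> R" "\<And>y. y \<in> R \<Longrightarrow> ip (r - s) y = 0"
    using projection_onto_closed_subspace[OF \<open>closed R\<close> sub] by blast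
  have "r - s = 0"
  proof (rule nondegenerate)
    fix w
    obtain t where t: "\<And>v. a w v = ip t v" using Riesz_representation[OF form_antidual] by blast
    then have "t \<in> R" by (auto simp: R_def)
    then have "ip (r - s) t = 0" by (rule s(2))
    then show "a w (r - s) = 0" by (simp add: t ip_commute[of t "r - s"])
  qed
  with s(1) obtain w where "\<forall>v. a w v = ip r v" by (auto simp: R_def)
  then have "a w = g" by (simp add: fun_eq_iff r)
  then show thesis by (rule that)
qed

lemma a_inv: "g \<in> antidual scale \<Longrightarrow> a (inv a g) = g"
  by (rule f_inv_into_f) (metis surjective rangeI)

lemma norm_inv_le:
  assumes g: "g \<in> antidual scale" and "0 \<le> K" and "\<And>v. norm (g v) \<le> K * norm v"
  shows "norm (inv a g) \<le> K / \<beta>"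
  using inf_sup[of K "inv a g"] assms beta_pos by (simp add: a_inv field_simps)

text \<open>Surjectivity transfers the inf-sup constant to the adjoint: testing with the solution \<open>w\<close> of
  \<open>a w = ip z\<close>, which satisfies \<open>\<beta> * norm w \<le> norm z\<close>, recovers \<open>(norm z)\<^sup>2\<close>.\<close>

lemma adjoint: "inf_sup_form scale ip (adjoint_form a) M \<beta>"
proof unfold_locales
  show "sesquilinear_form scale (adjoint_form a)" by (rule sesquilinear_adjoint_form[OF sesq])
  show "norm (adjoint_form a w v) \<le> M * norm w * norm v" for w v
    using bound[of v w] by (simp add: adjoint_form_def norm_conj mult_ac)
  show "M > 0" "\<beta> > 0" by (rule M_pos beta_pos)+
next
  fix K z assume K: "0 \<le> K" "\<And>v. norm (adjoint_form a z v) \<le> K * norm v"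
  define w where "w = inv a (ip z)"
  have w: "a w = ip z" unfolding w_def by (rule a_inv[OF ip_in_antidual])
  have wn: "norm w \<le> norm z / \<beta>"
    unfolding w_def by (intro norm_inv_le ip_in_antidual Cauchy_Schwarz) simp
  have "(norm z)\<^sup>2 = norm (a w z)" by (simp add: w ip_self del: of_real_power)
  also have "\<dots> \<le> K * norm w" using K(2)[of w] by (simp add: adjoint_form_def norm_conj)
  also have "\<dots> \<le> K * (norm z / \<beta>)" using wn K(1) by (rule mult_left_mono)
  finally have "norm z * (\<beta> * norm z) \<le> norm z * K"
    using beta_pos by (simp add: field_simps power2_eq_square)
  then show "\<beta> * norm z \<le> K" using K(1) by (cases "z = 0") auto
next
  fix v assume "\<And>w. adjoint_form a w v = 0"
  then have "norm (a v w) \<le> 0 * norm w" for w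
    by (metis adjoint_form_def conj_0 conj_conj mult_zero_left norm_zero order_refl)
  then have "\<beta> * norm v \<le> 0" by (intro inf_sup) simp_all
  then show "v = 0" using beta_pos by (simp add: mult_le_0_iff)
qed

end

section \<open>Stability of the discretisation passes to the limit\<close>

text \<open>The inf-sup inequality itself follows by approximating \<open>w\<close>. Nondegeneracy is where the finite
  dimension of the discrete spaces is essential: for \<open>x\<close> in a discrete space close to \<open>z\<close>, the
  solvable discrete problem gives \<open>w\<close> with \<open>a w x = ip x x\<close> and \<open>\<beta> * norm w \<le> norm x\<close>. If all
  \<open>a w z\<close> vanish, then \<open>(norm x)\<^sup>2 = a w (x - z)\<close> forces \<open>x\<close>, and with it \<open>z\<close>, to be small.\<close>

lemma inf_sup_form_of_discrete_inf_sup: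
  fixes scale :: "'k::real_or_complex \<Rightarrow> 'v::banach \<Rightarrow> 'v"
  assumes H: "hilbert_space_over scale ip"
    and sesq: "sesquilinear_form scale a"
    and bound: "\<And>w v. norm (a w v) \<le> M * norm w * norm v"
    and M: "M > 0" and beta: "\<beta> > 0"
    and approx: "approximating_sequence scale V"
    and discrete: "\<And>n w K. n \<ge> 1 \<Longrightarrow> w \<in> V n \<Longrightarrow> 0 \<le> K \<Longrightarrow>
        (\<And>v. v \<in> V n \<Longrightarrow> norm (a w v) \<le> K * norm v) \<Longrightarrow> \<beta> * norm w \<le> K"
  shows "inf_sup_form scale ip a M \<beta>"
proof -
  interpret hilbert_space_over scale ip by (rule H)
  have sub: "subspace (V n)" if "n \<ge> 1" for n
    using approx that by (simp add: approximating_sequence_def)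
  have dist0: "(\<lambda>n. infdist v (V n)) \<longlonglongrightarrow> 0" for v
    using approx by (simp add: approximating_sequence_def)
  have near: "\<exists>n\<ge>1. \<exists>x\<in>V n. norm (v - x) < e" if "e > 0" for v e
  proof -
    have "eventually (\<lambda>n. infdist v (V n) < e \<and> n \<ge> 1) sequentially"
      using order_tendstoD(2)[OF dist0 that] eventually_ge_at_top by (rule eventually_conj)
    then obtain n where n: "infdist v (V n) < e" "n \<ge> 1"
      using eventually_happens'[OF sequentially_bot] by blast
    have ne: "V n \<noteq> {}" using subspace_0[OF sub[OF n(2)]] by auto
    have "\<exists>x\<in>V n. dist v x < e"
    proof (rule ccontr)
      assume "\<not> ?thesis"
      then have "e \<le> infdist v (V n)"
        unfolding infdist_notempty[OF ne] by (intro cINF_greatest[OF ne]) force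
      then show False using n(1) by simp
    qed
    then show ?thesis using n(2) by (auto simp: dist_norm)
  qed
  have anti: "a w \<in> antidual scale" for w
    using bound by (rule form_in_antidual[OF sesq]) (rule scale_of_real)
  show ?thesis
  proof unfold_locales
    fix K w assume K: "0 \<le> K" "\<And>v. norm (a w v) \<le> K * norm v"
    show "\<beta> * norm w \<le> K"
    proof (rule field_le_epsilon)
      fix e :: real assume e: "e > 0"
      obtain n x where n: "n \<ge> 1" and x: "x \<in> V n" "norm (w - x) < e / (M + \<beta>)"
        using near[of "e / (M + \<beta>)" w] e M beta by auto
      have "\<beta> * norm x \<le> K + M * norm (w - x)"
      proof (rule discrete[OF n x(1)])
        fix v
        have "norm (a x v) \<le> norm (a w v) + norm (a (w - x) v)"
          using norm_triangle_ineq4[of "a w v" "a (w - x) v"] by (simp add: form_diff_left[OF sesq])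
        also have "\<dots> \<le> (K + M * norm (w - x)) * norm v"
          using K(2)[of v] bound[of "w - x" v] by (simp add: distrib_right)
        finally show "norm (a x v) \<le> (K + M * norm (w - x)) * norm v" .
      qed (use K(1) M in simp)
      moreover have "\<beta> * norm w \<le> \<beta> * norm x + \<beta> * norm (w - x)"
        using norm_triangle_sub[of w x] beta by (simp add: distrib_left[symmetric])
      ultimately have "\<beta> * norm w \<le> K + (M + \<beta>) * norm (w - x)" by (simp add: distrib_right)
      also have "\<dots> \<le> K + e" using x(2) M beta by (simp add: field_simps)
      finally show "\<beta> * norm w \<le> K + e" .
    qed
  next
    fix z assume z: "\<And>w. a w z = 0"
    have "norm z \<le> 0"
    proof (rule field_le_epsilon)
      fix e :: real assume e: "e > 0"
      \<comment> \<open>The final estimate is \<open>norm z \<le> (M / \<beta> + 1) * norm (z - x)\<close>.\<close>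
      define d where "d = e / (M / \<beta> + 1)"
      have d: "d > 0" using e M beta by (simp add: d_def add_pos_pos)
      obtain n x where n: "n \<ge> 1" and x: "x \<in> V n" "norm (z - x) < d"
        using near[OF d] by blast
      obtain B where B: "finite B" "span B = V n"
        using approx n by (auto simp: approximating_sequence_def)
      obtain w where w: "w \<in> span B" "\<And>v. v \<in> span B \<Longrightarrow> a w v = ip x v"
      proof (rule finite_dimensional_solvable[OF sesq anti B(1) _ ip_in_antidual[of x]])
        fix w assume w: "w \<in> span B" "\<And>v. v \<in> span B \<Longrightarrow> a w v = 0"
        then have "\<beta> * norm w \<le> 0" using B(2) by (intro discrete[OF n]) simp_all
        then show "w = 0" using beta by (simp add: mult_le_0_iff)
      qed blast
      have wn: "\<beta> * norm w \<le> norm x"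
        using w B(2) by (intro discrete[OF n]) (simp_all add: Cauchy_Schwarz)
      have "(norm x)\<^sup>2 = norm (a w x)" using w(2)[of x] x(1) B(2) by (simp add: ip_self del: of_real_power)
      also have "\<dots> = norm (a w (z - x))"
        by (simp add: form_diff_right[OF sesq] z)
      also have "\<dots> \<le> M * norm w * norm (z - x)" by (rule bound)
      also have "\<dots> \<le> M * (norm x / \<beta>) * norm (z - x)"
        using wn M beta by (intro mult_right_mono mult_left_mono) (auto simp: field_simps)
      finally have "norm x * norm x \<le> norm x * (M / \<beta> * norm (z - x))"
        by (simp add: power2_eq_square field_simps)
      then have "norm x \<le> M / \<beta> * norm (z - x)"
        using M beta by (cases "x = 0") (simp, metis mult_le_cancel_left_pos zero_less_norm_iff)
      then have "norm z \<le> (M / \<beta> + 1) * norm (z - x)"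
        using norm_triangle_sub[of z x] by (simp add: distrib_right)
      also have "\<dots> \<le> (M / \<beta> + 1) * d" using x(2) M beta by (intro mult_left_mono) auto
      also have "\<dots> = 0 + e"
      proof -
        have "M / \<beta> + 1 > 0" using M beta by (simp add: add_pos_pos)
        then show ?thesis by (simp add: d_def)
      qed
      finally show "norm z \<le> 0 + e" .
    qed
    then show "z = 0" by simp
  qed (use sesq bound M beta in auto)
qed

section \<open>Quasi-optimality and duality\<close>

lemma le_mult_infdist:
  assumes "W \<noteq> {}" "c > 0" "\<And>y. y \<in> W \<Longrightarrow> x \<le> c * dist w y"
  shows "x \<le> c * infdist w W"
proof -
  have "x / c \<le> infdist w W"
    unfolding infdist_notempty[OF assms(1)]
    using assms by (intro cINF_greatest) (auto simp: field_simps)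
  then show ?thesis using assms(2) by (simp add: field_simps)
qed

context inf_sup_form
begin

text \<open>Here \<open>w - e\<close> is the Galerkin solution in \<open>W\<close> for the exact solution \<open>w\<close>. The plain triangle
  inequality would give the constant \<open>\<beta> + M\<close> instead of \<open>M\<close>. In a Hilbert space a bounded projection other
  than \<open>0\<close> and the identity has the same norm as its complement. This is seen by exchanging the
  lengths of the components \<open>p \<in> W\<close> and \<open>e\<close> of \<open>p + e\<close>: the sum keeps its norm, and the stability
  bound for the component in \<open>W\<close> turns into one for \<open>e\<close>.\<close>

lemma Galerkin_error_le:
  assumes sub: "subspace W"
    and discrete: "\<And>w K. w \<in> W \<Longrightarrow> 0 \<le> K \<Longrightarrow> (\<And>v. v \<in> W \<Longrightarrow> norm (a w v) \<le> K * norm v)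
        \<Longrightarrow> \<beta> * norm w \<le> K"
    and e: "\<And>v. v \<in> W \<Longrightarrow> a e v = 0"
    and w: "w - e \<in> W"
  shows "\<beta> * norm e \<le> M * infdist w W"
proof -
  have projection: "\<beta> * norm p \<le> M * norm (p + q)"
    if "p \<in> W" "\<And>v. v \<in> W \<Longrightarrow> a q v = 0" for p q
  proof (rule discrete[OF that(1)])
    fix v assume "v \<in> W"
    then have "a p v = a (p + q) v" by (simp add: form_simps that(2))
    then show "norm (a p v) \<le> M * norm (p + q) * norm v" by (simp add: bound)
  qed (use M_pos in simp)
  show ?thesis
  proof (rule le_mult_infdist)
    show "W \<noteq> {}" using w by auto
    show "M > 0" by (rule M_pos)
    fix y assume y: "y \<in> W"
    define p where "p = w - e - y"
    have p: "p \<in> W" unfolding p_def by (intro subspace_diff sub w y)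
    \<comment> \<open>If \<open>p = 0\<close> there are no lengths to exchange, but then \<open>\<beta> \<le> M\<close> suffices.\<close>
    have "\<beta> * norm e \<le> M * norm (p + e)"
    proof (cases "p = 0 \<or> e = 0")
      case True
      then show ?thesis using beta_norm_le[of e] M_pos by auto
    next
      case False
      define r where "r = norm e / norm p"
      define s where "s = norm p / norm e"
      have "\<beta> * norm (r *\<^sub>R p) \<le> M * norm (r *\<^sub>R p + s *\<^sub>R e)"
      proof (rule projection)
        show "r *\<^sub>R p \<in> W" by (rule scaleR_in_subspace[OF sub p])
        show "a (s *\<^sub>R e) v = 0" if "v \<in> W" for v
          using e[OF that] by (simp add: scale_of_real[symmetric] form_simps)
      qed
      moreover have "norm (r *\<^sub>R p) = norm e" using False by (simp add: r_def)
      moreover have "norm (r *\<^sub>R p + s *\<^sub>R e) = norm (p + e)"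
        unfolding r_def s_def using False by (intro norm_add_swap_lengths) auto
      ultimately show ?thesis by simp
    qed
    then show "\<beta> * norm e \<le> M * dist w y" by (simp add: p_def dist_norm)
  qed
qed

lemma inv_eqI: "a w = g \<Longrightarrow> inv a g = w"
proof -
  assume "a w = g"
  then have "a (inv a g) = a w" by (metis a_inv form_antidual)
  then have "\<beta> * norm (inv a g - w) \<le> 0" by (intro inf_sup) (simp_all add: form_simps)
  then show ?thesis using beta_pos by (simp add: mult_le_0_iff)
qed

text \<open>The dual problem represents \<open>g\<close> as \<open>v \<mapsto> conj (a v w)\<close>. Since \<open>a e\<close> vanishes on \<open>W\<close>, the dual
  solution \<open>w\<close> can be replaced by its difference to any element of \<open>W\<close>: this second approximation
  error is the gain of the duality argument.\<close>

lemma functional_of_Galerkin_error_le: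
  assumes sub: "subspace W" and g: "g \<in> antidual scale"
    and e: "\<And>v. v \<in> W \<Longrightarrow> a e v = 0"
  shows "norm (g e) \<le> M * norm e * infdist (inv (adjoint_form a) g) W"
proof -
  interpret adj: inf_sup_form scale ip "adjoint_form a" M \<beta> by (rule adjoint)
  define w where "w = inv (adjoint_form a) g"
  have "g e = conj (a e w)"
    using adj.a_inv[OF g] by (metis w_def adjoint_form_def)
  then have ge: "norm (g e) = norm (a e w)" by (simp add: norm_conj)
  have "norm (a e w) \<le> M * norm e * infdist w W"
  proof (cases "e = 0")
    case False
    show ?thesis
    proof (rule le_mult_infdist)
      show "W \<noteq> {}" using subspace_0[OF sub] by auto
      show "M * norm e > 0" using False M_pos by simp
      fix y assume "y \<in> W"
      then have "a e w = a e (w - y)" by (simp add: form_simps e)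
      then show "norm (a e w) \<le> M * norm e * dist w y"
        by (simp add: bound dist_norm)
    qed
  qed (simp add: form_simps)
  then show ?thesis by (simp add: ge w_def)
qed

text \<open>The set whose supremum defines \<open>gamma\<close> is bounded because the inverse operator is. This
  matters: on the reals \<open>Sup\<close> dominates the elements of bounded sets only.\<close>

context
  fixes \<kappa> :: "'z::banach \<Rightarrow> 'v \<Rightarrow> 'k" and K :: real and W
  assumes anti: "\<And>f. \<kappa> f \<in> antidual scale"
    and K: "\<And>f v. norm (\<kappa> f v) \<le> K * norm f * norm v" "0 \<le> K"
    and sub: "subspace W"
begin

lemma bdd_above_distances: "bdd_above (insert 0 {infdist (inv a (\<kappa> f)) W |f. norm f = 1})"
proof -
  have "infdist (inv a (\<kappa> f)) W \<le> K / \<beta>" if "norm f = 1" for f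
  proof -
    have "infdist (inv a (\<kappa> f)) W \<le> norm (inv a (\<kappa> f))"
      using infdist_le[OF subspace_0[OF sub]] by simp
    also have "\<dots> \<le> K / \<beta>"
      using K(1)[of f] that by (intro norm_inv_le anti K(2)) simp
    finally show ?thesis .
  qed
  then have "bdd_above {infdist (inv a (\<kappa> f)) W |f. norm f = 1}" by (intro bdd_aboveI) auto
  then show ?thesis by simp
qed

lemma infdist_le_gamma: "norm f = 1 \<Longrightarrow> infdist (inv a (\<kappa> f)) W \<le> gamma a \<kappa> W"
  unfolding gamma_def sup_nonneg_def by (intro cSup_upper bdd_above_distances) auto

lemma gamma_nonneg: "0 \<le> gamma a \<kappa> W"
  unfolding gamma_def sup_nonneg_def by (intro cSup_upper bdd_above_distances) auto

end

end

theorem theorem6p3: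
  fixes scaleV :: "'k::real_or_complex \<Rightarrow> 'v::banach \<Rightarrow> 'v"
    and ipV :: "'v \<Rightarrow> 'v \<Rightarrow> 'k"
    and scaleH :: "'k \<Rightarrow> 'h::banach \<Rightarrow> 'h"
    and ipH :: "'h \<Rightarrow> 'h \<Rightarrow> 'k"
    and scaleX :: "'k \<Rightarrow> 'x::banach \<Rightarrow> 'x"
    and a :: "'v \<Rightarrow> 'v \<Rightarrow> 'k"
    and M \<beta> :: real
    and V :: "nat \<Rightarrow> 'v set"
    and j :: "'v \<Rightarrow> 'h"
    and \<iota> :: "'x \<Rightarrow> 'v \<Rightarrow> 'k"
    and L :: 'x
    and u :: 'v
    and un :: "nat \<Rightarrow> 'v"
  assumes "hilbert_space_over scaleV ipV"
    and "\<exists>D::'v set. countable D \<and> closure D = UNIV"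
    and "sesquilinear_form scaleV a"
    and "M > 0"
    and "\<forall>v w. norm (a v w) \<le> M * norm v * norm w"
    and "approximating_sequence scaleV V"
    and "\<beta> > 0"
    and "\<forall>n\<ge>1. \<forall>w\<in>V n. sup_nonneg {norm (a w v) |v. v \<in> V n \<and> norm v = 1} \<ge> \<beta> * norm w"
    and "hilbert_space_over scaleH ipH"
    and "densely_embedded scaleV scaleH j"
    and "banach_space_over scaleX"
    and "embedded_in_antidual scaleV scaleX \<iota>"
    and "\<forall>v. a u v = \<iota> L v"
    and "\<forall>n\<ge>1. un n \<in> V n \<and> (\<forall>v\<in>V n. a (un n) v = \<iota> L v)"
  shows "\<forall>n\<ge>1. norm (j (u - un n))
           \<le> M\<^sup>2 / \<beta> * gamma a \<iota> (V n)
               * gamma (adjoint_form a) (gelfand_embedding ipH j) (V n) * norm L"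
proof (intro allI impI)
  fix n :: nat assume n: "n \<ge> 1"
  interpret H: hilbert_space_over scaleH ipH by (rule assms(9))
  interpret X: banach_space_over scaleX by (rule assms(11))
  have discrete: "\<beta> * norm w \<le> K"
    if "m \<ge> 1" "w \<in> V m" "0 \<le> K" "\<And>v. v \<in> V m \<Longrightarrow> norm (a w v) \<le> K * norm v" for m w K
  proof -
    have "\<beta> * norm w \<le> Sup (insert 0 {norm (a w v) |v. v \<in> V m \<and> norm v = 1})"
      using assms(8) that(1,2) by (simp add: sup_nonneg_def)
    also have "\<dots> \<le> K" using that(3) that(4) by (intro cSup_least) force+
    finally show ?thesis .
  qed
  interpret A: inf_sup_form scaleV ipV a M \<beta>
    using assms(1,3-7) discrete by (intro inf_sup_form_of_discrete_inf_sup) auto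
  interpret A': inf_sup_form scaleV ipV "adjoint_form a" M \<beta> by (rule A.adjoint)
  have sub: "A.subspace (V n)" using assms(6) n by (simp add: approximating_sequence_def)

  obtain cX where cX: "cX > 0" "\<And>f. onorm (\<iota> f) \<le> cX * norm f"
    using assms(12) by (auto simp: embedded_in_antidual_def)
  have \<iota>_anti: "\<iota> f \<in> antidual scaleV" for f using assms(12) by (auto simp: embedded_in_antidual_def)
  have \<iota>_bound: "norm (\<iota> f v) \<le> cX * norm f * norm v" for f v
    using onorm[OF A.bounded_linear_antidual[OF \<iota>_anti[of f]], of v]
      mult_right_mono[OF cX(2)[of f] norm_ge_zero[of v]] by simp
  have \<iota>_scaleR: "\<iota> (r *\<^sub>R f) v = of_real r * \<iota> f v" for r f v
    using assms(12) X.scale_of_real[of r f, symmetric] by (simp add: embedded_in_antidual_def)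
  have \<iota>_zero: "\<iota> 0 v = 0" for v using \<iota>_scaleR[of 0 0 v] by simp

  obtain cH where cH: "cH > 0" "\<And>v. norm (j v) \<le> cH * norm v"
    using assms(10) by (auto simp: densely_embedded_def)
  interpret j: Vector_Spaces.linear scaleV scaleH j
    using assms(10) by (simp add: densely_embedded_def)
  have "bounded_linear j"
  proof (rule bounded_linear_intro)
    show "j (r *\<^sub>R v) = r *\<^sub>R j v" for r v
      by (simp add: A.scale_of_real[symmetric] H.scale_of_real[symmetric] j.scale)
    show "norm (j v) \<le> norm v * cH" for v using cH(2)[of v] by (simp add: mult.commute)
  qed (rule j.add)
  then have j_cont: "continuous_on UNIV j" by (rule bounded_linear.continuous_on) (rule continuous_on_id)
  have ipH_anti: "ipH f \<in> antidual scaleH" for f by (rule H.ip_in_antidual)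
  define \<kappa> where "\<kappa> = gelfand_embedding ipH j"
  have \<kappa>: "\<kappa> f v = ipH f (j v)" for f v by (simp add: \<kappa>_def gelfand_embedding_def)
  have \<kappa>_anti: "\<kappa> f \<in> antidual scaleV" for f
    unfolding antidual_def mem_Collect_eq
  proof (intro conjI allI)
    have "continuous_on UNIV (\<lambda>v. ipH f (j v))"
      using ipH_anti[of f] by (intro continuous_on_compose2[OF _ j_cont]) (auto simp: antidual_def)
    then show "continuous_on UNIV (\<kappa> f)" by (simp add: \<kappa> fun_eq_iff cong: continuous_on_cong)
  qed (simp_all add: \<kappa> j.add j.scale H.ip_simps)
  have \<kappa>_bound: "norm (\<kappa> f v) \<le> cH * norm f * norm v" for f v
    using H.Cauchy_Schwarz[of f "j v"] mult_left_mono[OF cH(2)[of v] norm_ge_zero[of f]]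
    by (simp add: \<kappa> mult_ac)

  define e where "e = u - un n"
  define \<gamma> where "\<gamma> = gamma a \<iota> (V n)"
  define \<gamma>' where "\<gamma>' = gamma (adjoint_form a) \<kappa> (V n)"
  have \<gamma>: "\<gamma> \<ge> 0" unfolding \<gamma>_def
    using cX(1) by (intro A.gamma_nonneg[OF \<iota>_anti \<iota>_bound _ sub]) simp
  have \<gamma>': "\<gamma>' \<ge> 0" unfolding \<gamma>'_def
    using cH(1) by (intro A'.gamma_nonneg[OF \<kappa>_anti \<kappa>_bound _ sub]) simp
  have un: "un n \<in> V n" and orth: "a e v = 0" if "v \<in> V n" for v
    using assms(13,14) n that by (auto simp: e_def A.form_simps)

  have energy: "\<beta> * norm e \<le> M * \<gamma> * norm L"
  proof (cases "L = 0")
    case True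
    have "\<beta> * norm e \<le> M * infdist u (V n)"
      using discrete[OF n] orth un[OF A.subspace_0[OF sub]]
      by (intro A.Galerkin_error_le sub) (auto simp: e_def)
    also have "u = 0"
    proof -
      have "a u = a 0" using assms(13) True by (simp add: fun_eq_iff \<iota>_zero A.form_simps)
      then show ?thesis by (metis A.inv_eqI)
    qed
    finally show ?thesis using True A.subspace_0[OF sub] by simp
  next
    case False
    \<comment> \<open>The quantity \<open>gamma\<close> only sees data of norm 1, so the whole problem is rescaled.\<close>
    define r where "r = inverse (norm L)"
    have r: "r > 0" "r * norm L = 1" using False by (simp_all add: r_def)
    have "a (r *\<^sub>R u) = \<iota> (r *\<^sub>R L)"
      using assms(13) by (simp add: fun_eq_iff \<iota>_scaleR A.scale_of_real[symmetric] A.form_simps)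
    then have inv: "inv a (\<iota> (r *\<^sub>R L)) = r *\<^sub>R u" by (rule A.inv_eqI)
    have "\<beta> * norm (r *\<^sub>R e) \<le> M * infdist (r *\<^sub>R u) (V n)"
    proof (rule A.Galerkin_error_le[OF sub discrete[OF n]])
      show "a (r *\<^sub>R e) v = 0" if "v \<in> V n" for v
        using orth[OF that] by (simp add: A.scale_of_real[symmetric] A.form_simps)
      have "r *\<^sub>R un n \<in> V n" by (rule A.scaleR_in_subspace[OF sub un[OF A.subspace_0[OF sub]]])
      then show "r *\<^sub>R u - r *\<^sub>R e \<in> V n" by (simp add: e_def algebra_simps)
    qed
    also have "infdist (r *\<^sub>R u) (V n) \<le> \<gamma>"
      unfolding inv[symmetric] \<gamma>_def using cX(1) r
      by (intro A.infdist_le_gamma[OF \<iota>_anti \<iota>_bound _ sub]) auto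
    finally have "r * (\<beta> * norm e) \<le> M * \<gamma>" using assms(4) r(1) by (simp add: mult_ac)
    then have "norm L * (r * (\<beta> * norm e)) \<le> norm L * (M * \<gamma>)" by (rule mult_left_mono) simp
    moreover have "norm L * (r * (\<beta> * norm e)) = \<beta> * norm e"
      using r(2) by (metis mult.assoc mult.commute mult_1)
    ultimately have "\<beta> * norm e \<le> norm L * (M * \<gamma>)" by (simp only:)
    then show ?thesis by (simp add: mult_ac)
  qed

  \<comment> \<open>The dual datum is the normalised error in the pivot space.\<close>
  have duality: "norm (j e) \<le> M * norm e * \<gamma>'"
  proof (cases "j e = 0")
    case True
    then show ?thesis using assms(4) \<gamma>' by simp
  next
    case False
    define f where "f = inverse (norm (j e)) *\<^sub>R j e"
    have f: "norm f = 1" using False by (simp add: f_def)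
    have "\<kappa> f e = of_real (norm (j e))"
      using False by (simp add: \<kappa> f_def H.ip_scaleR_left H.ip_self power2_eq_square)
    then have "norm (j e) \<le> M * norm e * infdist (inv (adjoint_form a) (\<kappa> f)) (V n)"
      using A.functional_of_Galerkin_error_le[OF sub \<kappa>_anti[of f] orth] by simp
    also have "infdist (inv (adjoint_form a) (\<kappa> f)) (V n) \<le> \<gamma>'"
      unfolding \<gamma>'_def using cH(1) f
      by (intro A'.infdist_le_gamma[OF \<kappa>_anti \<kappa>_bound _ sub]) auto
    finally show ?thesis using assms(4) by (simp add: mult_left_mono)
  qed
  also have "M * norm e * \<gamma>' \<le> M * (M * \<gamma> * norm L / \<beta>) * \<gamma>'"
    using energy assms(4,7) \<gamma>' by (intro mult_right_mono mult_left_mono) (auto simp: field_simps)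
  also have "\<dots> = M\<^sup>2 / \<beta> * \<gamma> * \<gamma>' * norm L" by (simp add: power2_eq_square)
  finally show "norm (j (u - un n))
           \<le> M\<^sup>2 / \<beta> * gamma a \<iota> (V n)
               * gamma (adjoint_form a) (gelfand_embedding ipH j) (V n) * norm L"
    unfolding e_def \<gamma>_def \<gamma>'_def \<kappa>_def .
qed

end
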